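(* For every integer $d\geqslant 2$, we have $n(2,d)\geqslant b(d)$.
   Context: A box in $\mathbb{R}^d$ is an axis-parallel $d$-dimensional cuboid (a product of $d$ non-degenerate closed intervals). Two boxes in $\mathbb{R}^d$ are $k$-neighborly if their intersection has dimension at least $d-k$ and at most $d-1$. $n(k,d)$ denotes the maximum number of boxes in $\mathbb{R}^d$ that are pairwise $k$-neighborly. Let $(a(n))_{n\geqslant 1}$ be the non-decreasing sequence of integers that lists every integer $m\geqslant 2$, where each $m$ of the form $3\cdot 2^r$ ($r\geqslant 0$ an integer) appears exactly twice and every other $m\geqslant 2$ appears exactly once; thus $a=2,3,3,4,5,6,6,7,8,9,10,11,12,12,13,\dots$. Define $b(2)=4$ and $b(d)=4+a(1)+a(2)+\cdots+a(d-2)$ for $d\geqslant 3$. *)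

theory Defs
  imports "HOL-Analysis.Analysis"
begin

text \<open>The space \<open>\<real>\<^sup>d\<close> is rendered as \<^typ>\<open>real ^ 'n\<close> with \<open>d = CARD('n)\<close>.\<close>

definition is_box :: "(real ^ 'n) set \<Rightarrow> bool" where
  "is_box B \<longleftrightarrow> (\<exists>l u. (\<forall>i. l $ i < u $ i) \<and> B = cbox l u)"

text \<open>The dimension is an integer and \<^term>\<open>aff_dim {} = -1\<close>, so for \<open>k \<le> d\<close>
  neighborly boxes have nonempty intersection. The notion is meant for \<open>k \<le> d\<close> only.\<close>

definition neighborly :: "nat \<Rightarrow> (real ^ 'n) set \<Rightarrow> (real ^ 'n) set \<Rightarrow> bool" where
  "neighborly k A B \<longleftrightarrow>
     int CARD('n) - int k \<le> aff_dim (A \<inter> B) \<and> aff_dim (A \<inter> B) \<le> int CARD('n) - 1"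

text \<open>A box is never neighborly to itself (the intersection has dimension \<open>d\<close>), so sets of boxes
  suffice. \<^const>\<open>Max\<close> is only meaningful for finite sets; the cardinalities occurring here
  are at most \<open>2\<^sup>d\<close> when \<open>k \<le> d\<close>.\<close>

definition max_neighborly :: "nat \<Rightarrow> 'n::finite itself \<Rightarrow> nat" where
  "max_neighborly k (_ :: 'n itself) =
     Max {card F | F :: (real ^ 'n) set set.
            finite F \<and> (\<forall>B\<in>F. is_box B) \<and> pairwise (neighborly k) F}"

definition multiplicity_in_a :: "nat \<Rightarrow> nat" where
  "multiplicity_in_a m = (if m < 2 then 0 else if \<exists>r. m = 3 * 2 ^ r then 2 else 1)"

text \<open>The sequence is indexed from 1; the value at 0 is a dummy fixed only to make the
  description unique.\<close>

definition lists_a :: "(nat \<Rightarrow> nat) \<Rightarrow> bool" where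
  "lists_a f \<longleftrightarrow> f 0 = 0 \<and> mono_on {1..} f \<and>
     (\<forall>m. finite {n. 1 \<le> n \<and> f n = m} \<and> card {n. 1 \<le> n \<and> f n = m} = multiplicity_in_a m)"

definition seq_a :: "nat \<Rightarrow> nat" where
  "seq_a = (THE f. lists_a f)"

definition seq_b :: "nat \<Rightarrow> nat" where
  "seq_b d = 4 + (\<Sum>i = 1..d - 2. seq_a i)"

lemma lists_a_le_iff:
  assumes f: "lists_a f" and n: "1 \<le> n"
  shows "f n \<le> m \<longleftrightarrow> n \<le> (\<Sum>j\<le>m. multiplicity_in_a j)"
proof -
  let ?S = "{n. 1 \<le> n \<and> f n \<le> m}"
  have U: "?S = (\<Union>j\<in>{..m}. {n. 1 \<le> n \<and> f n = j})" by auto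
  have fin: "finite ?S" unfolding U using f by (simp add: lists_a_def)
  have card: "card ?S = (\<Sum>j\<le>m. multiplicity_in_a j)"
    unfolding U using f by (subst card_UN_disjoint) (auto simp: lists_a_def)
  have mono: "f i \<le> f j" if "1 \<le> i" "i \<le> j" for i j
    using f that unfolding lists_a_def mono_on_def by auto
  show ?thesis
  proof
    assume "f n \<le> m"
    have "{1..n} \<subseteq> ?S"
    proof
      fix i assume "i \<in> {1..n}"
      then show "i \<in> ?S" using mono[of i n] \<open>f n \<le> m\<close> by auto
    qed
    then show "n \<le> (\<Sum>j\<le>m. multiplicity_in_a j)"
      using card_mono[OF fin, of "{1..n}"] card by simp
  next
    assume le: "n \<le> (\<Sum>j\<le>m. multiplicity_in_a j)"
    show "f n \<le> m"
    proof (rule ccontr)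
      assume "\<not> f n \<le> m"
      have "?S \<subseteq> {1..<n}"
      proof
        fix i assume "i \<in> ?S"
        then show "i \<in> {1..<n}" using mono[OF n, of i] \<open>\<not> f n \<le> m\<close> by force
      qed
      then have "card ?S \<le> card {1..<n}" by (intro card_mono) auto
      then show False using card le n by simp
    qed
  qed
qed

lemma ex1_lists_a: "\<exists>!f. lists_a f"
proof (rule ex_ex1I)
  define N where "N m = (\<Sum>j\<le>m. multiplicity_in_a j)" for m
  define f where "f n = (if n = 0 then 0 else LEAST m. n \<le> N m)" for n
  have N_Suc: "N (Suc m) = N m + multiplicity_in_a (Suc m)" for m by (simp add: N_def)
  have N_ge: "m \<le> N (Suc m)" for m
  proof (induction m)
    case (Suc m)
    have "1 \<le> multiplicity_in_a (Suc (Suc m))" by (simp add: multiplicity_in_a_def)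
    with Suc show ?case using N_Suc[of "Suc m"] by linarith
  qed simp
  have N_mono: "N i \<le> N j" if "i \<le> j" for i j
    using that by (rule lift_Suc_mono_le[rotated]) (simp add: N_Suc)
  have le_iff: "f n \<le> m \<longleftrightarrow> n \<le> N m" if "1 \<le> n" for n m
  proof -
    have "n \<le> N (f n)" using that LeastI[of "\<lambda>m. n \<le> N m", OF N_ge] by (simp add: f_def)
    moreover have "f n \<le> m" if "n \<le> N m" using that \<open>1 \<le> n\<close> by (auto simp: f_def intro: Least_le)
    ultimately show ?thesis using N_mono[of "f n" m] by linarith
  qed
  have set_eq: "{n. 1 \<le> n \<and> f n = m} = (if m = 0 then {} else {N (m - 1)<..N m})" for m
  proof (cases m)
    case 0
    have "N 0 = 0" by (simp add: N_def multiplicity_in_a_def)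
    then show ?thesis using 0 le_iff[of _ 0] by auto
  next
    case (Suc k)
    have "f n = Suc k \<longleftrightarrow> n \<le> N (Suc k) \<and> \<not> n \<le> N k" if "1 \<le> n" for n
      using le_iff[OF that, of k] le_iff[OF that, of "Suc k"] by linarith
    then show ?thesis using Suc by auto
  qed
  have "card {n. 1 \<le> n \<and> f n = m} = multiplicity_in_a m" for m
    unfolding set_eq by (cases m) (auto simp: N_Suc multiplicity_in_a_def)
  moreover have "finite {n. 1 \<le> n \<and> f n = m}" for m unfolding set_eq by simp
  moreover have "mono_on {1..} f"
  proof (rule mono_onI)
    fix i j :: nat assume "i \<in> {1..}" "j \<in> {1..}" "i \<le> j"
    then show "f i \<le> f j" using le_iff[of i "f j"] le_iff[of j "f j"] by simp
  qed
  ultimately show "\<exists>f. lists_a f" unfolding lists_a_def by (intro exI[of _ f]) (auto simp: f_def)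
next
  fix f g assume fg: "lists_a f" "lists_a g"
  show "f = g"
  proof
    fix n show "f n = g n"
    proof (cases "n = 0")
      case True then show ?thesis using fg by (simp add: lists_a_def)
    next
      case False
      then have "f n \<le> m \<longleftrightarrow> g n \<le> m" for m
        using lists_a_le_iff[OF fg(1)] lists_a_le_iff[OF fg(2)] by simp
      then have "f n \<le> g n" "g n \<le> f n" by blast+
      then show ?thesis by simp
    qed
  qed
qed

lemma lists_a_seq_a: "lists_a seq_a"
  unfolding seq_a_def by (rule theI'[OF ex1_lists_a])

end

theory Submission
  imports Defs
begin

text \<open>Boxes are encoded by words over \<open>{0, 1, *}\<close>; the codimension of the intersection of two boxes is
  the number of positions where one word has 0 and the other has 1.

  Think of \<open>m\<close> points as leaves of a binary tree whose \<open>m - 1\<close> inner nodes are the coordinates,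
  a point being the word of left/right turns on its path. A pair of points gets
  the word that overlays both paths and has \<open>*\<close> at the node where they split. Two pairs splitting at the
  same depth are at distance 1 or 2; pairs splitting at different depths are at distance 0 or 1, which
  is repaired by appending a code word, all at mutual distance 1, for the depth. Stopping the tree at
  blocks of 2 or 3 points (or of 3, with one more code word) and repeating each point of a block with 2 (or 3)
  code words of its own yields \<open>(m choose 2) + 3 * 2 ^ k\<close> words of length \<open>m + k\<close> whenever
  \<open>3 * 2 ^ k \<le> 2 * m \<le> 6 * 2 ^ k\<close>. In that range \<open>a(m + k - 1) = m\<close>, so this number is
  \<open>b(m + k)\<close>.\<close>

section \<open>Words over {0, 1, *}, their distance, and codes at mutual distance 1\<close>

fun wdist :: "bool option list \<Rightarrow> bool option list \<Rightarrow> nat" where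
  "wdist (a # u) (b # v) = (if a \<noteq> None \<and> b \<noteq> None \<and> a \<noteq> b then 1 else 0) + wdist u v"
| "wdist _ _ = 0"

lemma wdist_append:
  "length u = length v \<Longrightarrow> wdist (u @ u') (v @ v') = wdist u v + wdist u' v'"
  by (induction u v rule: list_induct2) auto

lemma wdist_self [simp]: "wdist u u = 0"
  by (induction u) auto

lemma wdist_stars [simp]:
  "wdist (replicate n None) v = 0" "wdist v (replicate n None) = 0"
proof -
  show "wdist (replicate n None) v = 0"
    by (induction n arbitrary: v) (simp, case_tac v, auto)
  show "wdist v (replicate n None) = 0"
    by (induction v arbitrary: n) (simp, case_tac n, auto)
qed

lemma wdist_commute: "wdist u v = wdist v u"
  by (induction u v rule: wdist.induct) auto

lemma wdist_eq_card:
  assumes "length u = n" "length v = n"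
  shows "wdist u v = card {i. i < n \<and> u ! i \<noteq> None \<and> v ! i \<noteq> None \<and> u ! i \<noteq> v ! i}"
  using assms
proof (induction n arbitrary: u v)
  case (Suc n)
  obtain a u' b v' where uv: "u = a # u'" "v = b # v'"
    using Suc.prems by (metis length_Suc_conv)
  let ?D = "\<lambda>x y i. x ! i \<noteq> None \<and> y ! i \<noteq> None \<and> x ! i \<noteq> (y ! i :: bool option)"
  have split: "{i. i < Suc n \<and> ?D u v i} =
      (if ?D u v 0 then {0} else {}) \<union> Suc ` {i. i < n \<and> ?D u' v' i}"
    unfolding uv using less_Suc_eq_0_disj by (auto simp: image_iff)
  have "card {i. i < Suc n \<and> ?D u v i} = (if ?D u v 0 then 1 else 0) + card {i. i < n \<and> ?D u' v' i}"
    unfolding split by (subst card_Un_disjoint) (auto simp: card_image)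
  then show ?case using Suc.IH[of u' v'] Suc.prems by (simp add: uv)
qed simp

text \<open>The paths to the leaves of a caterpillar tree: \<open>a\<close> right turns, then one
  left turn. For \<open>a\<close> from 0 to \<open>n\<close> this gives \<open>n + 1\<close> words,
  the last with right turns only; beyond \<open>n\<close> that last word repeats.\<close>

fun stair :: "nat \<Rightarrow> nat \<Rightarrow> bool option list" where
  "stair 0 a = []"
| "stair (Suc n) 0 = Some False # replicate n None"
| "stair (Suc n) (Suc a) = Some True # stair n a"

lemma length_stair [simp]: "length (stair n a) = n"
  by (induction n a rule: stair.induct) auto

lemma wdist_stair:
  "\<lbrakk>a \<le> n; b \<le> n\<rbrakk> \<Longrightarrow> wdist (stair n a) (stair n b) = (if a = b then 0 else 1)"
proof (induction n arbitrary: a b)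
  case (Suc n)
  then show ?case by (cases a; cases b) auto
qed simp

section \<open>Codes and pair systems, built along a binary tree\<close>

definition neighborly_code :: "nat \<Rightarrow> nat \<Rightarrow> bool option list set \<Rightarrow> bool" where
  "neighborly_code k n W \<longleftrightarrow> finite W \<and> (\<forall>w\<in>W. length w = n) \<and>
     (\<forall>u\<in>W. \<forall>v\<in>W. u \<noteq> v \<longrightarrow> wdist u v \<in> {1..k})"

definition cdist :: "bool option list \<times> nat \<Rightarrow> bool option list \<times> nat \<Rightarrow> nat" where
  "cdist p q = wdist (fst p) (fst q) + (if snd p = snd q then 0 else 1)"

lemma cdist_commute: "cdist p q = cdist q p"
  by (auto simp: cdist_def wdist_commute)

text \<open>\<open>C\<close> holds the words of the points. \<open>P\<close> holds the words of the pairs, with the code word for the depth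
  replaced by a colour: any two colours count as distance 1.\<close>

definition pair_system ::
  "nat \<Rightarrow> nat \<Rightarrow> bool option list set \<Rightarrow> (bool option list \<times> nat) set \<Rightarrow> bool" where
  "pair_system n k C P \<longleftrightarrow>
     neighborly_code 1 n C \<and> finite P \<and> (\<forall>p\<in>P. length (fst p) = n \<and> snd p < k) \<and>
     (\<forall>c\<in>C. \<forall>p\<in>P. wdist c (fst p) \<le> 1) \<and>
     (\<forall>p\<in>P. \<forall>q\<in>P. p \<noteq> q \<longrightarrow> cdist p q \<in> {1..2})"

text \<open>A block at the bottom of the tree, each point repeated with \<open>t\<close> colours.
  Distinct points contribute 1 and distinct colours contribute 1.\<close>

lemma pair_system_product:
  assumes "neighborly_code 1 n C"
  shows "pair_system n t C (C \<times> {..<t})"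
proof -
  have d: "wdist c c' = (if c = c' then 0 else 1)" if "c \<in> C" "c' \<in> C" for c c'
    using assms that by (auto simp: neighborly_code_def)
  show ?thesis
    using assms unfolding pair_system_def
    by (auto simp: neighborly_code_def cdist_def d)
qed

lemma stair_code:
  "neighborly_code 1 n (stair n ` {..n})" "card (stair n ` {..n}) = Suc n"
proof -
  show "neighborly_code 1 n (stair n ` {..n})"
    by (auto simp: neighborly_code_def wdist_stair)
  have "inj_on (stair n) {..n}"
    by (intro inj_onI) (metis atMost_iff wdist_self wdist_stair zero_neq_one)
  then show "card (stair n ` {..n}) = Suc n" by (simp add: card_image)
qed

text \<open>A new root coordinate joins two trees on disjoint coordinates. A pair with one point on
  each side is starred at the root and gets the fresh colour \<open>k\<close>. Against an old pair
  the colour counts 1 and the words at most 1, which is the purpose of the condition between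
  \<open>C\<close> and \<open>P\<close> in \<open>pair_system\<close>.\<close>

lemma pair_system_join:
  assumes 1: "pair_system n1 k C1 P1" and 2: "pair_system n2 k C2 P2"
  shows "\<exists>C P. pair_system (Suc (n1 + n2)) (Suc k) C P \<and> card C = card C1 + card C2 \<and>
    card P = card P1 + card P2 + card C1 * card C2"
proof -
  define fl where "fl u = Some False # u @ replicate n2 None" for u
  define fr where "fr u = Some True # replicate n1 None @ u" for u
  define fm where "fm c = (None # fst c @ snd c, k)" for c :: "bool option list \<times> bool option list"
  define C where "C = fl ` C1 \<union> fr ` C2"
  define Pl where "Pl = map_prod fl id ` P1"
  define Pr where "Pr = map_prod fr id ` P2"
  define Pm where "Pm = fm ` (C1 \<times> C2)"
  have fin: "finite C1" "finite C2" "finite P1" "finite P2"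
    and len: "\<And>c. c \<in> C1 \<Longrightarrow> length c = n1" "\<And>c. c \<in> C2 \<Longrightarrow> length c = n2"
      "\<And>p. p \<in> P1 \<Longrightarrow> length (fst p) = n1" "\<And>p. p \<in> P2 \<Longrightarrow> length (fst p) = n2"
    and col: "\<And>p. p \<in> P1 \<Longrightarrow> snd p < k" "\<And>p. p \<in> P2 \<Longrightarrow> snd p < k"
    and le1: "\<And>c p. c \<in> C1 \<Longrightarrow> p \<in> P1 \<Longrightarrow> wdist c (fst p) \<le> 1"
      "\<And>c p. c \<in> C2 \<Longrightarrow> p \<in> P2 \<Longrightarrow> wdist c (fst p) \<le> 1"
    and dP: "\<And>p q. p \<in> P1 \<Longrightarrow> q \<in> P1 \<Longrightarrow> p \<noteq> q \<Longrightarrow> cdist p q \<in> {1..2}"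
      "\<And>p q. p \<in> P2 \<Longrightarrow> q \<in> P2 \<Longrightarrow> p \<noteq> q \<Longrightarrow> cdist p q \<in> {1..2}"
    using 1 2 by (auto simp: pair_system_def neighborly_code_def)
  have dC: "wdist c c' = (if c = c' then 0 else 1)" if "c \<in> C1 \<and> c' \<in> C1 \<or> c \<in> C2 \<and> c' \<in> C2" for c c'
    using 1 2 that by (auto simp: pair_system_def neighborly_code_def)
  have ll: "wdist (fl u) (fl v) = wdist u v" if "length u = n1" "length v = n1" for u v
    using that by (simp add: fl_def wdist_append)
  have rr: "wdist (fr u) (fr v) = wdist u v" for u v
    by (simp add: fr_def wdist_append)
  \<comment> \<open>Each side is padded with stars on the coordinates of the other, so only the root
    counts.\<close>
  have lr: "wdist (fl u) (fr v) = 1" "wdist (fr v) (fl u) = 1" if "length u = n1" for u v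
    using that by (simp_all add: fl_def fr_def wdist_append)
  have lm: "wdist (fl u) (fst (fm c)) = wdist u (fst c)" if "length u = n1" "length (fst c) = n1" for u c
    using that by (simp add: fl_def fm_def wdist_append)
  have rm: "wdist (fr u) (fst (fm c)) = wdist u (snd c)" if "length (fst c) = n1" for u c
    using that by (simp add: fr_def fm_def wdist_append)
  have mm: "cdist (fm c) (fm c') = wdist (fst c) (fst c') + wdist (snd c) (snd c')"
    if "length (fst c) = n1" "length (fst c') = n1" for c c'
    using that by (simp add: fm_def cdist_def wdist_append)
  have inj: "inj fl" "inj fr" by (auto simp: inj_def fl_def fr_def)
  have injm: "inj_on fm (C1 \<times> C2)"
    using len by (auto simp: inj_on_def fm_def)
  have code: "neighborly_code 1 (Suc (n1 + n2)) C"
    unfolding neighborly_code_def C_def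
    using fin by (auto simp: len ll rr lr dC) (auto simp: fl_def fr_def len)
  have dPl: "cdist p q \<in> {1..2}" if p: "p \<in> Pl" and q: "q \<in> Pl" and "p \<noteq> q" for p q
  proof -
    obtain p' where p': "p = map_prod fl id p'" "p' \<in> P1"
      using p unfolding Pl_def by (rule imageE)
    obtain q' where q': "q = map_prod fl id q'" "q' \<in> P1"
      using q unfolding Pl_def by (rule imageE)
    with p' show ?thesis using dP(1)[of p' q'] \<open>p \<noteq> q\<close>
      by (cases "p' = q'") (auto simp: cdist_def ll len)
  qed
  have dPr: "cdist p q \<in> {1..2}" if p: "p \<in> Pr" and q: "q \<in> Pr" and "p \<noteq> q" for p q
  proof -
    obtain p' where p': "p = map_prod fr id p'" "p' \<in> P2"
      using p unfolding Pr_def by (rule imageE)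
    obtain q' where q': "q = map_prod fr id q'" "q' \<in> P2"
      using q unfolding Pr_def by (rule imageE)
    with p' show ?thesis using dP(2)[of p' q'] \<open>p \<noteq> q\<close>
      by (cases "p' = q'") (auto simp: cdist_def rr)
  qed
  \<comment> \<open>These pairs share the colour \<open>k\<close>; their left points contribute 0 or
    1, likewise their right points, and at least one of the two differs.\<close>
  have dPm: "cdist p q \<in> {1..2}" if p: "p \<in> Pm" and q: "q \<in> Pm" and "p \<noteq> q" for p q
  proof -
    obtain c where c: "p = fm c" "c \<in> C1 \<times> C2"
      using p unfolding Pm_def by (rule imageE)
    obtain c' where c': "q = fm c'" "c' \<in> C1 \<times> C2"
      using q unfolding Pm_def by (rule imageE)
    with c have "c \<noteq> c'" using \<open>p \<noteq> q\<close> by auto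
    with c c' show ?thesis by (cases c; cases c') (auto simp: mm len dC)
  qed
  have pair: "length u = n1 \<and> a < k \<and> (\<forall>c\<in>C1. wdist c u \<le> 1)" if "(u, a) \<in> P1" for u a
    using that len(3) col(1) le1(1) by force
  have pair': "length u = n2 \<and> a < k \<and> (\<forall>c\<in>C2. wdist c u \<le> 1)" if "(u, a) \<in> P2" for u a
    using that len(4) col(2) le1(2) by force
  have dlr: "cdist p q \<in> {1..2}" if p: "p \<in> Pl" and q: "q \<in> Pr" for p q
    using that by (auto simp: Pl_def Pr_def cdist_def lr dest!: pair)
  have dlm: "cdist p q \<in> {1..2}" if p: "p \<in> Pl" and q: "q \<in> Pm" for p q
  proof -
    obtain p' where p': "p = map_prod fl id p'" "p' \<in> P1"
      using p unfolding Pl_def by (rule imageE)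
    obtain c where c: "q = fm c" "c \<in> C1 \<times> C2"
      using q unfolding Pm_def by (rule imageE)
    with p' have "wdist (fst p) (fst q) \<le> 1"
      using le1(1)[of "fst c" p'] by (auto simp: lm len wdist_commute)
    moreover have "snd p \<noteq> snd q" using c p' col by (fastforce simp: fm_def)
    ultimately show ?thesis by (simp add: cdist_def)
  qed
  have drm: "cdist p q \<in> {1..2}" if p: "p \<in> Pr" and q: "q \<in> Pm" for p q
  proof -
    obtain p' where p': "p = map_prod fr id p'" "p' \<in> P2"
      using p unfolding Pr_def by (rule imageE)
    obtain c where c: "q = fm c" "c \<in> C1 \<times> C2"
      using q unfolding Pm_def by (rule imageE)
    with p' have "wdist (fst p) (fst q) \<le> 1"
      using le1(2)[of "snd c" p'] by (auto simp: rm len wdist_commute)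
    moreover have "snd p \<noteq> snd q" using c p' col by (fastforce simp: fm_def)
    ultimately show ?thesis by (simp add: cdist_def)
  qed
  \<comment> \<open>Within one side the old bound applies, across sides only the root counts, and a
    pair split at the root is compared through its point on the side of \<open>c\<close>.\<close>
  have CP: "wdist c (fst p) \<le> 1" if "c \<in> C" "p \<in> Pl \<union> Pr \<union> Pm" for c p
    using that by (auto simp: C_def Pl_def Pr_def Pm_def ll rr lr lm rm len dC dest!: pair pair')
  have lenP: "length (fst p) = Suc (n1 + n2) \<and> snd p < Suc k" if "p \<in> Pl \<union> Pr \<union> Pm" for p
    using that by (auto simp: Pl_def Pr_def Pm_def fl_def fr_def fm_def len dest!: pair pair')
  have "pair_system (Suc (n1 + n2)) (Suc k) C (Pl \<union> Pr \<union> Pm)"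
    unfolding pair_system_def
  proof (intro conjI ballI impI)
    fix p q assume "p \<in> Pl \<union> Pr \<union> Pm" "q \<in> Pl \<union> Pr \<union> Pm" "p \<noteq> q"
    then show "cdist p q \<in> {1..2}"
      using dPl dPr dPm dlr dlm drm cdist_commute by (metis UnE)
  qed (use code CP lenP fin in \<open>auto simp: Pl_def Pr_def Pm_def\<close>)
  moreover have "card C = card C1 + card C2"
  proof -
    have "fl ` C1 \<inter> fr ` C2 = {}" by (auto simp: fl_def fr_def)
    moreover have "card (fl ` C1) = card C1" "card (fr ` C2) = card C2"
      using inj by (auto intro!: card_image intro: inj_on_subset)
    ultimately show ?thesis unfolding C_def using fin by (simp add: card_Un_disjoint)
  qed
  moreover have "card (Pl \<union> Pr \<union> Pm) = card P1 + card P2 + card C1 * card C2"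
  proof -
    have "Pl \<inter> Pr = {}" by (auto simp: Pl_def Pr_def fl_def fr_def)
    moreover have "(Pl \<union> Pr) \<inter> Pm = {}"
      by (auto simp: Pl_def Pr_def Pm_def fl_def fr_def fm_def)
    moreover have "card Pl = card P1" "card Pr = card P2"
      unfolding Pl_def Pr_def
      by (auto intro!: card_image inj_on_subset[OF prod.inj_map[OF _ inj_on_id]] inj)
    moreover have "card Pm = card C1 * card C2"
      unfolding Pm_def by (simp add: card_image injm card_cartesian_product)
    ultimately show ?thesis using fin
      by (simp add: card_Un_disjoint Pl_def Pr_def Pm_def)
  qed
  ultimately show ?thesis by blast
qed

text \<open>Halving \<open>m\<close> keeps both bounds with \<open>k\<close> lowered by one; joining
  the halves adds one colour and doubles the term \<open>3 * 2 ^ k\<close>. The blocks at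
  \<open>k = 0\<close> have two colours: 4 = 1 + 3 and 6 = 3 + 3.\<close>

lemma pair_system_exists:
  assumes "3 * 2 ^ k \<le> 2 * m" "m \<le> 3 * 2 ^ k"
  shows "\<exists>C P. pair_system (m - 1) (k + 2) C P \<and> card C = m \<and> card P = (m choose 2) + 3 * 2 ^ k"
proof -
  have product: "\<exists>C P. pair_system (s - 1) t C P \<and> card C = s \<and> card P = s * t" if "s \<ge> 1" for s t
    using pair_system_product[OF stair_code(1)[of "s - 1"], of t] stair_code(2)[of "s - 1"] that
    by (metis Suc_diff_1 card_cartesian_product card_lessThan less_eq_Suc_le One_nat_def)
  show ?thesis
    using assms
  proof (induction k arbitrary: m)
    case 0
    then have "m = 2 \<or> m = 3" by auto
    then show ?case using product[of m 2] by (auto simp: choose_two numeral_2_eq_2[symmetric])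
  next
    case (Suc k)
    show ?case
    \<comment> \<open>Here the halves would be 1 and 2, and 1 is out of range. A block of 3 points
      with 3 colours gives 9 = 3 + 6 instead.\<close>
    proof (cases "m = 3 \<and> k = 0")
      case True
      then show ?thesis using product[of 3 3] by (simp add: choose_two numeral_3_eq_3[symmetric])
    next
      case False
      define m1 m2 where "m1 = m div 2" and "m2 = m - m div 2"
      have m: "m = m1 + m2" by (simp add: m1_def m2_def)
      have lower: "3 * 2 ^ k \<le> 2 * m1"
      \<comment> \<open>For \<open>k > 0\<close> the lower bound \<open>3 * 2 ^ k\<close> on
        \<open>m\<close> is even, so rounding down is harmless; for \<open>k = 0\<close> excluding 3
        leaves \<open>m\<close> at least 4.\<close>
      proof (cases k)
        case 0
        then show ?thesis using False Suc.prems by (auto simp: m1_def)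
      next
        case (Suc j)
        then show ?thesis using Suc.prems by (auto simp: m1_def)
      qed
      have upper: "m2 \<le> 3 * 2 ^ k" using Suc.prems by (auto simp: m2_def)
      have "m1 \<le> m2" by (auto simp: m1_def m2_def)
      obtain C1 P1 where 1: "pair_system (m1 - 1) (k + 2) C1 P1" "card C1 = m1"
          "card P1 = (m1 choose 2) + 3 * 2 ^ k"
        using Suc.IH[of m1] lower upper \<open>m1 \<le> m2\<close> by auto
      obtain C2 P2 where 2: "pair_system (m2 - 1) (k + 2) C2 P2" "card C2 = m2"
          "card P2 = (m2 choose 2) + 3 * 2 ^ k"
        using Suc.IH[of m2] lower upper \<open>m1 \<le> m2\<close> by auto
      have "0 < (2::nat) ^ k" by simp
      then have "m1 \<ge> 1" using lower by linarith
      then have n: "Suc (m1 - 1 + (m2 - 1)) = m - 1" using \<open>m1 \<le> m2\<close> m by simp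
      \<comment> \<open>A pair of points lies left, lies right, or splits at the root.\<close>
      have "(m choose 2) = (m1 choose 2) + (m2 choose 2) + m1 * m2"
        unfolding m by (induction m2) (auto simp: numeral_2_eq_2)
      then show ?thesis
        using pair_system_join[OF 1(1) 2(1), unfolded n] 1(2,3) 2(2,3) m by (simp add: ac_simps)
    qed
  qed
qed

text \<open>The \<open>Suc k\<close> colours become the words of \<open>stair k\<close>, which are
  at mutual distance 1, so \<open>wdist\<close> reproduces \<open>cdist\<close> exactly.\<close>

lemma neighborly_code_of_pair_system:
  assumes "pair_system n (Suc k) C P"
  shows "\<exists>W. neighborly_code 2 (n + k) W \<and> card W = card P"
proof -
  define f where "f p = fst p @ stair k (snd p)" for p :: "bool option list \<times> nat"
  have d: "wdist (f p) (f q) = cdist p q" if "p \<in> P" "q \<in> P" for p q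
    using assms that by (auto simp: pair_system_def f_def wdist_append cdist_def wdist_stair less_Suc_eq_le)
  have "inj_on f P"
  proof (intro inj_onI, rule ccontr)
    fix p q assume "p \<in> P" "q \<in> P" "f p = f q" "p \<noteq> q"
    then have "cdist p q = 0" using d[of p q] by simp
    then show False using assms \<open>p \<in> P\<close> \<open>q \<in> P\<close> \<open>p \<noteq> q\<close> unfolding pair_system_def by fastforce
  qed
  moreover have "neighborly_code 2 (n + k) (f ` P)"
    using assms unfolding neighborly_code_def pair_system_def
    by (auto simp: d) (auto simp: f_def)
  ultimately show ?thesis using card_image by blast
qed

section \<open>From words to boxes\<close>

text \<open>After translation to the origin, the box spans the coordinate subspace of its
  non-degenerate sides.\<close>

lemma aff_dim_cbox_cart:
  fixes l u :: "real ^ 'n"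
  assumes "\<And>i. l $ i \<le> u $ i"
  shows "aff_dim (cbox l u) = int (card {i. l $ i < u $ i})"
proof -
  define v where "v = u - l"
  have v: "0 \<le> v $ i" for i using assms by (simp add: v_def)
  have mem: "x \<in> cbox 0 v \<longleftrightarrow> (\<forall>i. 0 \<le> x $ i \<and> x $ i \<le> v $ i)" for x
    by (simp add: mem_box_cart)
  have "span (cbox 0 v) = {x. \<forall>i. i \<notin> {i. 0 < v $ i} \<longrightarrow> x $ i = 0}" (is "_ = ?S")
  proof
    have "cbox 0 v \<subseteq> ?S"
      using v by (auto simp: mem) (metis order_antisym_conv order_less_le)
    moreover have "subspace ?S" by (simp add: subspace_def)
    ultimately show "span (cbox 0 v) \<subseteq> ?S" by (rule span_minimal)
    show "?S \<subseteq> span (cbox 0 v)"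
    proof
      fix x assume x: "x \<in> ?S"
      have "axis i (v $ i) \<in> cbox 0 v" for i
        using v by (auto simp: mem axis_def)
      then have "(\<Sum>i\<in>UNIV. (x $ i / v $ i) *\<^sub>R axis i (v $ i)) \<in> span (cbox 0 v)"
        by (intro span_sum span_scale span_base)
      moreover have "(\<Sum>i\<in>UNIV. (x $ i / v $ i) *\<^sub>R axis i (v $ i)) = x"
      proof -
        \<comment> \<open>Where \<open>v $ i = 0\<close>, membership in \<open>?S\<close> forces
          \<open>x $ i = 0\<close>, so the division by zero does no harm.\<close>
        have "x $ i / v $ i * v $ i = x $ i" for i
          using x v[of i] by (cases "v $ i = 0") auto
        then show ?thesis
          by (simp add: vec_eq_iff axis_def if_distrib[of "\<lambda>y. _ * y"] cong: if_cong)
      qed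
      ultimately show "x \<in> span (cbox 0 v)" by simp
    qed
  qed
  then have "dim (cbox 0 v) = dim ?S"
    using dim_span[of "cbox 0 v"] by simp
  also have "\<dots> = card {i. 0 < v $ i}"
    unfolding dim_vec_eq[symmetric] by (rule dim_substandard_cart)
  finally have "dim (cbox 0 v) = card {i. 0 < v $ i}" .
  moreover have "0 \<in> affine hull cbox 0 v"
    by (rule hull_inc) (simp add: mem v)
  moreover have "cbox l u = (+) l ` cbox 0 v"
    using cbox_translation[of l 0 v] by (simp add: v_def)
  ultimately show ?thesis
    by (simp add: aff_dim_translation_eq aff_dim_zero v_def)
qed

lemma cbox_Int_cart:
  fixes l u l' u' :: "real ^ 'n"
  shows "cbox l u \<inter> cbox l' u' = cbox (\<chi> i. max (l $ i) (l' $ i)) (\<chi> i. min (u $ i) (u' $ i))"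
  by (auto simp: mem_box_cart)

text \<open>The sides are [0,1], [1,2] and [0,2] for 0, 1 and *. Any two overlap in positive length,
  except 0 against 1, which meet in one point: each clash of letters costs exactly one
  dimension.\<close>

definition word_box :: "('n \<Rightarrow> nat) \<Rightarrow> bool option list \<Rightarrow> (real ^ 'n) set" where
  "word_box h w = cbox (\<chi> i. if w ! h i = Some True then 1 else 0)
                       (\<chi> i. if w ! h i = Some False then 1 else 2)"

lemma is_box_word_box: "is_box (word_box h w)"
  unfolding is_box_def word_box_def by (intro exI conjI[OF _ refl]) auto

lemma aff_dim_word_box_Int:
  fixes h :: "'n::finite \<Rightarrow> nat"
  assumes h: "bij_betw h UNIV {..<CARD('n)}"
    and len: "length w = CARD('n)" "length w' = CARD('n)"
  shows "aff_dim (word_box h w \<inter> word_box h w') = int CARD('n) - int (wdist w w')"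
proof -
  let ?D = "\<lambda>j. w ! j \<noteq> None \<and> w' ! j \<noteq> None \<and> w ! j \<noteq> w' ! j"
  let ?l = "\<lambda>a :: bool option. if a = Some True then 1 else 0 :: real"
  let ?u = "\<lambda>a :: bool option. if a = Some False then 1 else 2 :: real"
  have letter: "max (?l a) (?l b) < min (?u a) (?u b) \<longleftrightarrow> \<not> (a \<noteq> None \<and> b \<noteq> None \<and> a \<noteq> b)"
    for a b by (cases a; cases b) auto
  have "aff_dim (word_box h w \<inter> word_box h w') = int (card {i. \<not> ?D (h i)})"
    unfolding word_box_def cbox_Int_cart
    by (subst aff_dim_cbox_cart) (simp_all only: vec_lambda_beta letter, simp)
  also have "card {i. \<not> ?D (h i)} = CARD('n) - card {i. ?D (h i)}"
    by (subst card_Diff_subset[symmetric]) (auto intro!: arg_cong[where f = card])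
  also have "int \<dots> = int CARD('n) - int (card {i. ?D (h i)})"
    by (simp add: card_mono)
  also have "card {i. ?D (h i)} = card (h ` {i. ?D (h i)})"
    using h by (intro card_image[symmetric]) (auto simp: bij_betw_def intro: inj_on_subset)
  also have "h ` {i. ?D (h i)} = h ` UNIV \<inter> {j. ?D j}" by blast
  also have "\<dots> = {j. j < CARD('n) \<and> ?D j}"
    unfolding bij_betw_imp_surj_on[OF h] by auto
  also have "card \<dots> = wdist w w'"
    using wdist_eq_card[OF len] by simp
  finally show ?thesis .
qed

lemma boxes_of_neighborly_code:
  assumes "neighborly_code k CARD('n::finite) W"
  shows "\<exists>F :: (real ^ 'n) set set. finite F \<and> (\<forall>B\<in>F. is_box B) \<and> pairwise (neighborly k) F \<and>
    card F = card W"
proof -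
  obtain h :: "'n \<Rightarrow> nat" where h: "bij_betw h UNIV {..<CARD('n)}"
    using ex_bij_betw_finite_nat[of "UNIV :: 'n set"] by (auto simp: atLeast0LessThan)
  have dim: "aff_dim (word_box h u \<inter> word_box h v) = int CARD('n) - int (wdist u v)"
    if "u \<in> W" "v \<in> W" for u v
    using assms that by (intro aff_dim_word_box_Int h) (auto simp: neighborly_code_def)
  have d: "wdist u v \<in> {1..k}" if "u \<in> W" "v \<in> W" "u \<noteq> v" for u v
    using assms that by (auto simp: neighborly_code_def)
  have "inj_on (word_box h) W"
  proof (intro inj_onI, rule ccontr)
    fix u v assume uv: "u \<in> W" "v \<in> W" "word_box h u = word_box h v" "u \<noteq> v"
    \<comment> \<open>With equal boxes both intersections coincide, so
      \<open>wdist u v = wdist u u\<close>.\<close>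
    then have "wdist u v = 0" using dim[of u v] dim[of u u] by simp
    then show False using d[of u v] uv by simp
  qed
  moreover have "pairwise (neighborly k) (word_box h ` W)"
    unfolding pairwise_def neighborly_def
    by clarify (metis dim d atLeastAtMost_iff diff_left_mono of_nat_1 of_nat_mono)
  moreover have "finite W" using assms by (simp add: neighborly_code_def)
  ultimately show ?thesis
    by (intro exI[of _ "word_box h ` W"]) (auto simp: card_image is_box_word_box)
qed

section \<open>Finiteness behind the maximum\<close>

text \<open>Bounds the cardinalities in \<open>max_neighborly\<close>, so that its
  \<open>Max\<close> ranges over a finite set and dominates every family.\<close>

lemma card_neighborly_boxes_le:
  fixes F :: "(real ^ 'n) set set"
  assumes k: "k \<le> CARD('n)" and fin: "finite F"
    and box: "\<forall>B\<in>F. is_box B" and pw: "pairwise (neighborly k) F"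
  shows "card F \<le> 2 ^ CARD('n)"
proof -
  have "\<forall>B\<in>F. \<exists>l u. (\<forall>i. l $ i < u $ i) \<and> B = cbox l u"
    using box by (simp add: is_box_def)
  then obtain l u :: "(real ^ 'n) set \<Rightarrow> real ^ 'n"
    where lu: "\<And>B i. B \<in> F \<Longrightarrow> l B $ i < u B $ i" and B: "\<And>B. B \<in> F \<Longrightarrow> B = cbox (l B) (u B)"
    by metis
  have Int: "A \<inter> B = cbox (\<chi> i. max (l A $ i) (l B $ i)) (\<chi> i. min (u A $ i) (u B $ i))"
    if "A \<in> F" "B \<in> F" for A B
    using B that cbox_Int_cart by metis
  \<comment> \<open>As \<open>k\<close> is at most the dimension, two boxes always meet; hence every
    lower end is below every upper end.\<close>
  have cross: "l A $ i \<le> u B $ i" if "A \<in> F" "B \<in> F" for A B i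
  proof (cases "A = B")
    case False
    then have "0 \<le> aff_dim (A \<inter> B)"
      using pw k that by (force simp: pairwise_def neighborly_def)
    then have "A \<inter> B \<noteq> {}" by auto
    then obtain x where "x \<in> A" "x \<in> B" by auto
    then have "x \<in> cbox (l A) (u A)" "x \<in> cbox (l B) (u B)" using B that by auto
    then show ?thesis by (meson mem_box_cart order_trans)
  qed (use lu that in \<open>simp add: less_imp_le\<close>)
  txt \<open>The point \<open>p\<close> lies in every box. In a coordinate where \<open>A\<close> and \<open>B\<close> only touch, exactly one
    of them has \<open>p\<close> on its upper face, so the set \<open>s\<close> of these coordinates determines the box.\<close>
  define p where "p i = Max ((\<lambda>B. l B $ i) ` F)" for i
  have lp: "l A $ i \<le> p i" if "A \<in> F" for A i
    using fin that by (simp add: p_def)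
  have pu: "p i \<le> u A $ i" if "A \<in> F" for A i
    unfolding p_def using fin that cross by (subst Max_le_iff) auto
  define s where "s B = {i. u B $ i = p i}" for B
  have "inj_on s F"
  proof (intro inj_onI, rule ccontr)
    fix A B assume AB: "A \<in> F" "B \<in> F" and eq: "s A = s B" and "A \<noteq> B"
    then have "aff_dim (A \<inter> B) < int CARD('n)"
      using pw by (auto simp: pairwise_def neighborly_def)
    moreover have "max (l A $ i) (l B $ i) \<le> min (u A $ i) (u B $ i)" for i
      using AB cross by simp
    ultimately have "card {i. max (l A $ i) (l B $ i) < min (u A $ i) (u B $ i)} < CARD('n)"
      by (simp add: Int[OF AB] aff_dim_cbox_cart)
    then obtain i where "\<not> max (l A $ i) (l B $ i) < min (u A $ i) (u B $ i)"
      by (metis (no_types, lifting) UNIV_eq_I less_irrefl mem_Collect_eq)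
    \<comment> \<open>The larger lower end and the smaller upper end enclose \<open>p i\<close>, so
      both equal it; non-degeneracy puts them in different boxes.\<close>
    then have "l A $ i = p i \<and> u B $ i = p i \<or> l B $ i = p i \<and> u A $ i = p i"
      using lu[OF AB(1), of i] lu[OF AB(2), of i] lp[OF AB(1), of i] lp[OF AB(2), of i]
        pu[OF AB(1), of i] pu[OF AB(2), of i] by linarith
    then have "(i \<in> s A) \<noteq> (i \<in> s B)"
      using lu[OF AB(1), of i] lu[OF AB(2), of i] by (auto simp: s_def)
    then show False using eq by simp
  qed
  then have "card F \<le> card (UNIV :: 'n set set)"
    by (intro card_inj_on_le) auto
  then show ?thesis by (simp add: card_UNIV_set)
qed

lemma card_le_max_neighborly:
  assumes "k \<le> CARD('n)" "finite F" "\<forall>B\<in>F. is_box B" "pairwise (neighborly k) F"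
  shows "card (F :: (real ^ 'n::finite) set set) \<le> max_neighborly k TYPE('n)"
  unfolding max_neighborly_def
proof (rule Max_ge)
  show "finite {card F | F :: (real ^ 'n) set set.
      finite F \<and> (\<forall>B\<in>F. is_box B) \<and> pairwise (neighborly k) F}"
    by (rule finite_subset[of _ "{..2 ^ CARD('n)}"])
      (use card_neighborly_boxes_le[OF assms(1)] in auto)
qed (use assms in blast)

section \<open>Closed forms for the two sequences\<close>

text \<open>Counts the terms of the sequence up to \<open>m\<close>: each of 2, ...,
  \<open>m\<close> once, and once more for each \<open>3 * 2 ^ r\<close>. Truncated subtraction
  covers \<open>m = 0\<close>.\<close>

lemma sum_multiplicity_in_a:
  "(\<Sum>j\<le>m. multiplicity_in_a j) = (m - 1) + card {r. 3 * 2 ^ r \<le> m}"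
proof -
  have inj: "inj (\<lambda>r. 3 * 2 ^ r :: nat)" by (auto simp: inj_def)
  have "multiplicity_in_a j = (if 2 \<le> j then 1 else 0) + (if \<exists>r. j = 3 * 2 ^ r then 1 else 0)" for j
  proof -
    have [simp]: "\<not> 3 * (2::nat) ^ r < 2" for r
      using one_le_power[of "2::nat" r] by linarith
    show ?thesis by (auto simp: multiplicity_in_a_def)
  qed
  then have "(\<Sum>j\<le>m. multiplicity_in_a j) =
      card {j. j \<le> m \<and> 2 \<le> j} + card {j. j \<le> m \<and> (\<exists>r. j = 3 * 2 ^ r)}"
    by (simp add: sum.distrib sum.If_cases Int_def)
  also have "{j. j \<le> m \<and> 2 \<le> j} = {2..m}" by auto
  also have "{j. j \<le> m \<and> (\<exists>r. j = 3 * 2 ^ r)} = (\<lambda>r. 3 * 2 ^ r) ` {r. 3 * 2 ^ r \<le> m}" by auto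
  also have "card \<dots> = card {r. 3 * 2 ^ r \<le> m}"
    by (rule card_image[OF inj_on_subset[OF inj]]) simp
  finally show ?thesis by simp
qed

text \<open>At least \<open>m - 1 + k\<close> terms are at most \<open>m\<close>, and at most
  \<open>m - 2 + k\<close> are at most \<open>m - 1\<close>. A doubled value
  \<open>m = 3 * 2 ^ k\<close> also fits the bounds with \<open>k + 1\<close>, which gives its
  second index.\<close>

lemma seq_a_eq:
  assumes "3 * 2 ^ k \<le> 2 * m" "m \<le> 3 * 2 ^ k"
  shows "seq_a (m + k - 1) = m"
proof -
  have "0 < (2::nat) ^ k" by simp
  then have m: "2 \<le> m" using assms by linarith
  note iff = lists_a_le_iff[OF lists_a_seq_a, of "m + k - 1", unfolded sum_multiplicity_in_a]
  have fin: "finite {r. 3 * 2 ^ r \<le> m}"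
  proof (rule finite_subset)
    show "{r. 3 * 2 ^ r \<le> m} \<subseteq> {..m}"
    proof
      fix r assume "r \<in> {r. 3 * 2 ^ r \<le> m}"
      then have "3 * 2 ^ r \<le> m" by simp
      then show "r \<in> {..m}" using less_exp[of r] by (simp only: atMost_iff)
    qed
  qed simp
  have "{..<k} \<subseteq> {r. 3 * 2 ^ r \<le> m}"
  proof
    fix r assume "r \<in> {..<k}"
    then have "(2::nat) ^ Suc r \<le> 2 ^ k" by (intro power_increasing) auto
    then show "r \<in> {r. 3 * 2 ^ r \<le> m}" using assms by simp
  qed
  from card_mono[OF fin this] have "k \<le> card {r. 3 * 2 ^ r \<le> m}" by simp
  then have "seq_a (m + k - 1) \<le> m" using iff[of m] m by simp
  moreover have "\<not> seq_a (m + k - 1) \<le> m - 1"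
  proof -
    have "{r. 3 * 2 ^ r \<le> m - 1} \<subseteq> {..<k}"
    proof
      fix r assume "r \<in> {r. 3 * 2 ^ r \<le> m - 1}"
      then have "3 * 2 ^ r \<le> m - 1" by simp
      then have "(2::nat) ^ r < 2 ^ k" using assms m by linarith
      then show "r \<in> {..<k}" by simp
    qed
    from card_mono[OF _ this] have "card {r. 3 * 2 ^ r \<le> m - 1} \<le> k" by simp
    then show ?thesis using iff[of "m - 1"] m by simp
  qed
  ultimately show ?thesis by simp
qed

text \<open>Passing from \<open>d\<close> to \<open>d + 1\<close> adds
  \<open>seq_a (d - 1) = m\<close>. Raising \<open>m\<close> adds this to the binomial; once
  \<open>m = 3 * 2 ^ k\<close>, raising \<open>k\<close> adds it to the other term.\<close>

lemma seq_b_eq: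
  assumes "d \<ge> 2"
  shows "\<exists>m k. d = m + k \<and> 3 * 2 ^ k \<le> 2 * m \<and> m \<le> 3 * 2 ^ k \<and> seq_b d = (m choose 2) + 3 * 2 ^ k"
  using assms
proof (induction d rule: nat_induct_at_least)
  case base
  show ?case by (intro exI[of _ 2] exI[of _ 0]) (simp add: seq_b_def choose_two)
next
  case (Suc d)
  then obtain m k where mk: "d = m + k" "3 * 2 ^ k \<le> 2 * m" "m \<le> 3 * 2 ^ k"
      "seq_b d = (m choose 2) + 3 * 2 ^ k" by blast
  have "Suc d - 2 = Suc (d - 2)" "Suc (d - 2) = d - 1" using Suc.hyps by auto
  then have b: "seq_b (Suc d) = (m choose 2) + 3 * 2 ^ k + m"
    using mk(4) seq_a_eq[OF mk(2,3)] mk(1) by (simp add: seq_b_def)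
  show ?case
  proof (cases "m < 3 * 2 ^ k")
    case True
    then show ?thesis using b mk
      by (intro exI[of _ "Suc m"] exI[of _ k]) (simp add: numeral_2_eq_2)
  next
    case False
    then show ?thesis using b mk
      by (intro exI[of _ m] exI[of _ "Suc k"]) simp
  qed
qed

theorem theorem4:
  fixes d :: nat
  assumes "CARD('n::finite) = d" and "d \<ge> 2"
  shows "max_neighborly 2 TYPE('n) \<ge> seq_b d"
proof -
  obtain m k where mk: "d = m + k" "3 * 2 ^ k \<le> 2 * m" "m \<le> 3 * 2 ^ k"
      "seq_b d = (m choose 2) + 3 * 2 ^ k"
    using seq_b_eq[OF assms(2)] by blast
  obtain C P where P: "pair_system (m - 1) (Suc (Suc k)) C P" "card P = (m choose 2) + 3 * 2 ^ k"
    using pair_system_exists[OF mk(2,3)] by auto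
  \<comment> \<open>This makes \<open>m\<close> positive, so \<open>m - 1\<close> is not truncated:
    \<open>m - 1\<close> tree coordinates and \<open>k + 1\<close> for the \<open>k + 2\<close>
    colours add up to \<open>d\<close>.\<close>
  have "0 < (2::nat) ^ k" by simp
  then have "m - 1 + Suc k = d" using mk by linarith
  then obtain W where "neighborly_code 2 d W" "card W = seq_b d"
    using neighborly_code_of_pair_system[OF P(1)] P(2) mk(4) by auto
  then obtain F :: "(real ^ 'n) set set"
    where "finite F" "\<forall>B\<in>F. is_box B" "pairwise (neighborly 2) F" "card F = seq_b d"
    using boxes_of_neighborly_code[where 'n = 'n, of 2 W] assms(1) by auto
  then show ?thesis
    using card_le_max_neighborly[of 2 F] assms by simp
qed

end
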